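(* Let $m,p,n$ be positive integers. The number of ordered $m$-tuples $(P_1,\dots,P_m)$ of planar partitions of $[pn]$ such that $P_i$ is a refinement of $P_{i+1}$ for $i=1,\dots,m-1$, and $P_1$ is a $p$-partition (every block of $P_1$ has exactly $p$ elements), equals the Fuss-Catalan number $A_n^{mp}=\frac{1}{mpn+1}\binom{mpn+1}{n}$.
   Context: For a positive integer $N$, $[N]=\{1,\dots,N\}$. A set partition of $[N]$ is planar (non-crossing) if there do not exist $a<b<c<d$ in $[N]$ with $a,c$ in one block and $b,d$ in a different block. A partition $P$ is a refinement of $Q$ if every block of $P$ is contained in some block of $Q$. A $p$-partition of $[pn]$ is a set partition of $[pn]$ all of whose blocks have exactly $p$ elements. *)

theory Defs
  imports Complex_Main "HOL-Library.Disjoint_Sets"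
begin

definition planar_partition :: "nat \<Rightarrow> nat set set \<Rightarrow> bool" where
  "planar_partition N P \<longleftrightarrow>
     partition_on {1..N} P \<and>
     \<not> (\<exists>a b c d. a < b \<and> b < c \<and> c < d \<and>
          (\<exists>B\<in>P. \<exists>C\<in>P. B \<noteq> C \<and> a \<in> B \<and> c \<in> B \<and> b \<in> C \<and> d \<in> C))"

definition p_partition :: "nat \<Rightarrow> nat \<Rightarrow> nat set set \<Rightarrow> bool" where
  "p_partition p n P \<longleftrightarrow> partition_on {1..p * n} P \<and> (\<forall>B\<in>P. card B = p)"

text \<open>The tuple $(P_1,\dots,P_m)$ is a list of length $m$, so $P_i$ is the list entry
  with index $i-1$.\<close>

definition planar_chains :: "nat \<Rightarrow> nat \<Rightarrow> nat \<Rightarrow> nat set set list set" where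
  "planar_chains m p n =
     {Ps. length Ps = m \<and>
          (\<forall>i<m. planar_partition (p * n) (Ps ! i)) \<and>
          (\<forall>i. i + 1 < m \<longrightarrow> refines {1..p * n} (Ps ! i) (Ps ! (i + 1))) \<and>
          p_partition p n (Ps ! 0)}"

definition fuss_catalan :: "nat \<Rightarrow> nat \<Rightarrow> real" where
  "fuss_catalan k n = 1 / real (k * n + 1) * real ((k * n + 1) choose n)"

end

theory Submission
  imports Defs "HOL-Library.FuncSet" "HOL-Computational_Algebra.Formal_Power_Series"
begin

text \<open>
  Fixing the coarsest partition \<open>P\<^sub>m\<close>, the chains below it are independent choices of a chain of
  length \<open>m - 1\<close> on each block of \<open>P\<^sub>m\<close>. Hence the number of chains is a sum over noncrossing
  partitions of products of block weights that depend only on the size of the block. For any weight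
  with generating function \<open>F\<close> (with constant term 1), splitting off the block of the least
  element shows that the generating function \<open>G\<close> of such sums satisfies \<open>G(x) = F(x G(x))\<close>.
  Starting from \<open>F\<^sub>0 = 1 + x\<^sup>p\<close>, induction on \<open>m\<close> therefore gives
  \<open>F\<^sub>m = 1 + x\<^sup>p F\<^sub>m\<^bsup>mp\<^esup>\<close>, whose coefficient at \<open>x\<^bsup>pn\<^esup>\<close> is the Fuss-Catalan number.
\<close>

unbundle fps_syntax

section \<open>Noncrossing partitions and refinement\<close>

text \<open>The relation is directional: \<open>B\<close> owns the leftmost of the four points.
  Symmetry is restored in \<open>noncrossing\<close>, which ranges over ordered pairs of
  blocks.\<close>

definition crosses :: "nat set \<Rightarrow> nat set \<Rightarrow> bool" where
  "crosses B C \<longleftrightarrow> (\<exists>a b c d. a < b \<and> b < c \<and> c < d \<and> a \<in> B \<and> c \<in> B \<and> b \<in> C \<and> d \<in> C)"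

definition noncrossing :: "nat set set \<Rightarrow> bool" where
  "noncrossing P \<longleftrightarrow> (\<forall>B\<in>P. \<forall>C\<in>P. B \<noteq> C \<longrightarrow> \<not> crosses B C)"

text \<open>The ground set is arbitrary because the recursions below pass to blocks and to parts of
  a set cut at a point, which need not be intervals.\<close>

definition NC :: "nat set \<Rightarrow> nat set set set" where
  "NC A = {P. partition_on A P \<and> noncrossing P}"

lemma planar_partition_iff: "planar_partition N P \<longleftrightarrow> P \<in> NC {1..N}"
proof -
  have "(\<exists>a b c d. a < b \<and> b < c \<and> c < d \<and>
      (\<exists>B\<in>P. \<exists>C\<in>P. B \<noteq> C \<and> a \<in> B \<and> c \<in> B \<and> b \<in> C \<and> d \<in> C)) \<longleftrightarrow>
      (\<exists>B\<in>P. \<exists>C\<in>P. B \<noteq> C \<and> crosses B C)"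
    unfolding crosses_def by (rule iffI; elim exE bexE conjE; intro exI bexI conjI; assumption)
  then show ?thesis
    unfolding planar_partition_def NC_def noncrossing_def by auto
qed

lemma noncrossing_subset: "noncrossing P \<Longrightarrow> Q \<subseteq> P \<Longrightarrow> noncrossing Q"
  unfolding noncrossing_def by blast

lemma crosses_mono: "crosses B C \<Longrightarrow> B \<subseteq> B' \<Longrightarrow> C \<subseteq> C' \<Longrightarrow> crosses B' C'"
  unfolding crosses_def by blast

lemma not_crosses_separated:
  assumes "\<And>x y. x \<in> B \<Longrightarrow> y \<in> C \<Longrightarrow> x < (y::nat)"
  shows "\<not> crosses B C" "\<not> crosses C B"
  using assms unfolding crosses_def by (meson less_asym)+

lemma NC_partition: "P \<in> NC A \<Longrightarrow> partition_on A P"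
  by (simp add: NC_def)

lemma NC_finite: "finite A \<Longrightarrow> finite (NC A)"
  unfolding NC_def by (rule finite_subset[OF _ finitely_many_partition_on]) auto

lemma NC_finite_elem: "finite A \<Longrightarrow> P \<in> NC A \<Longrightarrow> finite P"
  using finite_elements NC_partition by blast

lemma NC_empty: "NC {} = {{}}"
  by (auto simp: NC_def partition_on_empty noncrossing_def)

lemma NC_subsets: "P \<in> NC A \<Longrightarrow> B \<in> P \<Longrightarrow> B \<subseteq> A"
  by (auto simp: NC_def partition_on_def)

text \<open>Pieces of different blocks cannot cross, since by \<open>crosses_mono\<close> their
  enclosing blocks would cross too; pieces of the same block are handled by
  \<open>g B\<close>.\<close>

lemma NC_glue_refinement:
  assumes P: "P \<in> NC A" and g: "\<And>B. B \<in> P \<Longrightarrow> g B \<in> NC B"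
  shows "(\<Union>B\<in>P. g B) \<in> NC A" "refines A (\<Union>B\<in>P. g B) P"
proof -
  have sub: "C \<subseteq> B" "C \<noteq> {}" if "B \<in> P" "C \<in> g B" for B C
    using g[OF that(1)] that(2) by (auto simp: NC_def partition_on_def)
  have un: "\<Union>(g B) = B" if "B \<in> P" for B
    using g[OF that] by (auto simp: NC_def partition_on_def)
  have disj: "B \<inter> B' = {}" if "B \<in> P" "B' \<in> P" "B \<noteq> B'" for B B'
    using P that unfolding NC_def partition_on_def disjoint_def by blast
  have "partition_on A (\<Union>B\<in>P. g B)"
  proof (rule partition_onI)
    have "\<Union> (\<Union>B\<in>P. g B) = (\<Union>B\<in>P. \<Union>(g B))"
      by blast
    also have "\<dots> = A"
      using un P by (simp add: NC_def partition_on_def)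
    finally show "\<Union> (\<Union>B\<in>P. g B) = A" .
    show "disjnt C C'" if CC: "C \<in> (\<Union>B\<in>P. g B)" "C' \<in> (\<Union>B\<in>P. g B)" "C \<noteq> C'" for C C'
    proof -
      obtain B B' where B: "B \<in> P" "C \<in> g B" "B' \<in> P" "C' \<in> g B'"
        using CC by blast
      show ?thesis
      proof (cases "B = B'")
        case True
        then show ?thesis
          using g[OF B(1)] B CC unfolding NC_def partition_on_def disjoint_def disjnt_def by blast
      next
        case False
        then show ?thesis
          using disj[OF B(1,3)] sub B unfolding disjnt_def by blast
      qed
    qed
    show "{} \<notin> (\<Union>B\<in>P. g B)"
      using sub by blast
  qed
  moreover have "noncrossing (\<Union>B\<in>P. g B)"
    unfolding noncrossing_def
  proof (intro ballI impI)
    fix C C' assume CC: "C \<in> (\<Union>B\<in>P. g B)" "C' \<in> (\<Union>B\<in>P. g B)" "C \<noteq> C'"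
    then obtain B B' where B: "B \<in> P" "C \<in> g B" "B' \<in> P" "C' \<in> g B'"
      by blast
    show "\<not> crosses C C'"
    proof (cases "B = B'")
      case True
      then show ?thesis
        using g[OF B(1)] B CC unfolding NC_def noncrossing_def by blast
    next
      case False
      then have "\<not> crosses B B'"
        using P B by (auto simp: NC_def noncrossing_def)
      then show ?thesis
        using crosses_mono sub B by blast
    qed
  qed
  ultimately show "(\<Union>B\<in>P. g B) \<in> NC A" "refines A (\<Union>B\<in>P. g B) P"
    using P sub by (auto simp: NC_def refines_def)
qed

lemma NC_split_refinement:
  assumes Q: "Q \<in> NC A" and ref: "refines A Q P" and B: "B \<in> P"
  shows "{C \<in> Q. C \<subseteq> B} \<in> NC B"
proof -
  have "partition_on B {C \<in> Q. C \<subseteq> B}"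
    using refines_obtains_subset[OF ref B] by simp
  moreover have "noncrossing {C \<in> Q. C \<subseteq> B}"
    using Q noncrossing_subset[of Q] by (auto simp: NC_def)
  ultimately show ?thesis
    by (simp add: NC_def)
qed

text \<open>A noncrossing refinement of \<open>P\<close> amounts to an independent choice of a
  noncrossing partition of every block. Distributing the product over the sums therefore enumerates
  the refinements.\<close>

lemma sum_prod_refinements:
  fixes f :: "nat set \<Rightarrow> 'a::comm_semiring_1"
  assumes A: "finite A" and P: "P \<in> NC A"
  shows "(\<Sum>Q | Q \<in> NC A \<and> refines A Q P. \<Prod>C\<in>Q. f C) = (\<Prod>B\<in>P. \<Sum>Q\<in>NC B. \<Prod>C\<in>Q. f C)"
proof -
  have finP: "finite P"
    using A P by (rule NC_finite_elem)
  have finB: "finite B" if "B \<in> P" for B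
    using finite_subset[OF NC_subsets[OF P that] A] .
  have un: "\<Union>P = A"
    using P by (auto simp: NC_def partition_on_def)
  have disj: "B \<inter> B' = {}" if "B \<in> P" "B' \<in> P" "B \<noteq> B'" for B B'
    using P that unfolding NC_def partition_on_def disjoint_def by blast
  have sub: "C \<subseteq> B" "C \<noteq> {}" if "g \<in> PiE P NC" "B \<in> P" "C \<in> g B" for g B C
    using that by (auto simp: NC_def partition_on_def PiE_def Pi_def)
  \<comment> \<open>A nonempty piece determines the block that contains it, so the choices on the
    blocks can be recovered from their union.\<close>
  have uniq: "B = B'" if "C \<noteq> {}" "C \<subseteq> B" "C \<subseteq> B'" "B \<in> P" "B' \<in> P" for B B' C
    using disj that by blast
  have "(\<Prod>B\<in>P. \<Sum>Q\<in>NC B. \<Prod>C\<in>Q. f C) = (\<Sum>g\<in>PiE P NC. \<Prod>B\<in>P. \<Prod>C\<in>g B. f C)"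
    by (rule prod_sum_PiE) (auto intro: finP NC_finite finB)
  also have "\<dots> = (\<Sum>g\<in>PiE P NC. \<Prod>C\<in>(\<Union>B\<in>P. g B). f C)"
  proof (rule sum.cong[OF refl])
    fix g assume g: "g \<in> PiE P NC"
    have "\<forall>B\<in>P. finite (g B)"
      using g finB NC_finite_elem by (auto simp: PiE_def Pi_def)
    moreover have "\<forall>B\<in>P. \<forall>B'\<in>P. B \<noteq> B' \<longrightarrow> g B \<inter> g B' = {}"
    proof (intro ballI impI Int_emptyI)
      fix B B' C assume *: "B \<in> P" "B' \<in> P" "B \<noteq> B'" "C \<in> g B" "C \<in> g B'"
      show False
        using uniq[of C B B'] sub[OF g *(1,4)] sub[OF g *(2,5)] * by blast
    qed
    ultimately show "(\<Prod>B\<in>P. \<Prod>C\<in>g B. f C) = (\<Prod>C\<in>(\<Union>B\<in>P. g B). f C)"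
      using finP by (simp add: prod.UNION_disjoint)
  qed
  also have "\<dots> = (\<Sum>Q | Q \<in> NC A \<and> refines A Q P. \<Prod>C\<in>Q. f C)"
  \<comment> \<open>The inverse sorts the pieces of \<open>Q\<close> by block; restricting it to
    \<open>P\<close> makes it extensional, as \<open>PiE\<close> demands.\<close>
  proof (rule sum.reindex_bij_witness[where j = "\<lambda>g. \<Union>B\<in>P. g B" and i = "\<lambda>Q. \<lambda>B\<in>P. {C \<in> Q. C \<subseteq> B}"])
    fix g assume g: "g \<in> PiE P NC"
    show "(\<Union>B\<in>P. g B) \<in> {Q. Q \<in> NC A \<and> refines A Q P}"
      using NC_glue_refinement[OF P, of g] g by (auto simp: PiE_def Pi_def)
    show "(\<lambda>B\<in>P. {C \<in> (\<Union>B\<in>P. g B). C \<subseteq> B}) = g"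
    proof
      fix B
      show "(\<lambda>B\<in>P. {C \<in> (\<Union>B\<in>P. g B). C \<subseteq> B}) B = g B"
      proof (cases "B \<in> P")
        case True
        have "C \<in> g B" if "C \<subseteq> B" "B' \<in> P" "C \<in> g B'" for B' C
          using uniq[of C B B'] sub[OF g that(2,3)] True that by simp
        then have "{C \<in> (\<Union>B\<in>P. g B). C \<subseteq> B} = g B"
          using sub(1)[OF g True] True by blast
        then show ?thesis
          using True by simp
      next
        case False
        then show ?thesis
          using g by (auto simp: PiE_def extensional_def)
      qed
    qed
  next
    fix Q assume "Q \<in> {Q. Q \<in> NC A \<and> refines A Q P}"
    then have Q: "Q \<in> NC A" "refines A Q P"
      by auto
    show "(\<lambda>B\<in>P. {C \<in> Q. C \<subseteq> B}) \<in> PiE P NC"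
      using NC_split_refinement[OF Q] by auto
    show "(\<Union>B\<in>P. (\<lambda>B\<in>P. {C \<in> Q. C \<subseteq> B}) B) = Q"
      using Q(2) by (auto simp: refines_def)
  qed simp
  finally show ?thesis ..
qed

section \<open>Weighted sums over noncrossing partitions\<close>

definition nc_sum :: "(nat \<Rightarrow> 'a::comm_semiring_1) \<Rightarrow> nat set \<Rightarrow> 'a" where
  "nc_sum f A = (\<Sum>P\<in>NC A. \<Prod>B\<in>P. f (card B))"

text \<open>
  Here \<open>v\<close> is a point to the left of \<open>A\<close>, and \<open>(B, Q)\<close> encodes the noncrossing partition of
  \<open>insert v A\<close> whose block containing \<open>v\<close> is \<open>insert v B\<close>. Giving the block of \<open>v\<close> its own
  weight \<open>h\<close> makes the sum recursive: splitting at the second smallest element of that block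
  only replaces \<open>h\<close> by its shift.
\<close>

definition pointed :: "nat \<Rightarrow> nat set \<Rightarrow> (nat set \<times> nat set set) set" where
  "pointed v A = {(B, Q). B \<subseteq> A \<and> partition_on (A - B) Q \<and> noncrossing (insert (insert v B) Q)}"

definition pointed_sum ::
  "(nat \<Rightarrow> 'a::comm_semiring_1) \<Rightarrow> (nat \<Rightarrow> 'a) \<Rightarrow> nat \<Rightarrow> nat set \<Rightarrow> 'a" where
  "pointed_sum f h v A = (\<Sum>(B, Q)\<in>pointed v A. h (card B) * (\<Prod>C\<in>Q. f (card C)))"

lemma nc_sum_empty: "nc_sum f {} = 1"
  by (simp add: nc_sum_def NC_empty)

lemma pointed_finite: "finite A \<Longrightarrow> finite (pointed v A)"
proof -
  assume A: "finite A"
  have "pointed v A \<subseteq> Pow A \<times> Pow (Pow A)"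
    by (auto simp: pointed_def partition_on_def)
  then show ?thesis
    using A by (simp add: finite_subset)
qed

text \<open>The distinguished block is stored without \<open>v\<close>, hence one element short; the
  shifted weight compensates for this.\<close>

lemma nc_sum_eq_pointed_sum:
  assumes A: "finite A" and v: "v \<notin> A"
  shows "nc_sum f (insert v A) = pointed_sum f (\<lambda>k. f (Suc k)) v A"
proof -
  define blk where "blk P = (THE B. B \<in> P \<and> v \<in> B)" for P :: "nat set set"
  have blk: "blk P = B" if "P \<in> NC (insert v A)" "B \<in> P" "v \<in> B" for P B
    unfolding blk_def using that
    by (intro the_equality) (auto simp: NC_def partition_on_def disjoint_def)
  have "pointed_sum f (\<lambda>k. f (Suc k)) v A = nc_sum f (insert v A)"
    unfolding nc_sum_def pointed_sum_def
  proof (rule sum.reindex_bij_witness[where j = "\<lambda>(B, Q). insert (insert v B) Q"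
        and i = "\<lambda>P. (blk P - {v}, P - {blk P})"])
    fix x assume "x \<in> pointed v A"
    then obtain B Q where x: "x = (B, Q)" and B: "B \<subseteq> A" and Q: "partition_on (A - B) Q"
      and nc: "noncrossing (insert (insert v B) Q)"
      by (auto simp: pointed_def)
    have vB: "v \<notin> B" and vQ: "insert v B \<notin> Q"
      using B Q v by (auto simp: partition_on_def)
    have finB: "finite B" and finQ: "finite Q"
      using A B Q finite_subset finite_elements[of "A - B" Q] by auto
    have "partition_on (insert v A) (insert (insert v B) Q)"
    proof (rule partition_onI)
      show "\<Union>(insert (insert v B) Q) = insert v A"
        using B Q by (auto simp: partition_on_def)
      have "disjnt (insert v B) C" if "C \<in> Q" for C
        using Q v B that by (auto simp: partition_on_def disjnt_def)
      then show "disjnt C D" if "C \<in> insert (insert v B) Q" "D \<in> insert (insert v B) Q" "C \<noteq> D" for C D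
        using that partition_onD2[OF Q] by (auto simp: disjnt_sym pairwise_def)
    qed (use Q in \<open>auto simp: partition_on_def\<close>)
    then have mem: "insert (insert v B) Q \<in> NC (insert v A)"
      using nc by (simp add: NC_def)
    then show "(case x of (B, Q) \<Rightarrow> insert (insert v B) Q) \<in> NC (insert v A)"
      by (simp add: x)
    have "blk (insert (insert v B) Q) = insert v B"
      using blk[OF mem] by simp
    then show "(blk (case x of (B, Q) \<Rightarrow> insert (insert v B) Q) - {v},
        (case x of (B, Q) \<Rightarrow> insert (insert v B) Q) - {blk (case x of (B, Q) \<Rightarrow> insert (insert v B) Q)}) = x"
      using vB vQ by (simp add: x)
    show "(\<Prod>B\<in>(case x of (B, Q) \<Rightarrow> insert (insert v B) Q). f (card B)) =
        (case x of (B, Q) \<Rightarrow> f (Suc (card B)) * (\<Prod>C\<in>Q. f (card C)))"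
      using finB finQ vB vQ by (simp add: x)
  next
    fix P assume P: "P \<in> NC (insert v A)"
    then have part: "partition_on (insert v A) P" and nc: "noncrossing P"
      by (auto simp: NC_def)
    obtain B where B: "B \<in> P" "v \<in> B"
      using part by (auto simp: partition_on_def)
    have [simp]: "blk P = B"
      using blk[OF P B] .
    show "(case (blk P - {v}, P - {blk P}) of (B, Q) \<Rightarrow> insert (insert v B) Q) = P"
      using B by (simp add: insert_absorb)
    have "A - (B - {v}) = insert v A - B"
      using B v by auto
    moreover have "partition_on (insert v A - B) (P - {B})"
    proof (rule partition_onI)
      show "\<Union>(P - {B}) = insert v A - B"
        using part B unfolding partition_on_def disjoint_def by blast
    qed (use part in \<open>auto simp: partition_on_def disjoint_def disjnt_def\<close>)
    moreover have "B - {v} \<subseteq> A"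
      using NC_subsets[OF P B(1)] by auto
    ultimately show "(blk P - {v}, P - {blk P}) \<in> pointed v A"
      using nc B by (simp add: pointed_def insert_absorb)
  qed
  then show ?thesis ..
qed

text \<open>With \<open>a\<close> as second smallest element of the block of \<open>v\<close>, the
  blocks of \<open>Q1\<close> sit in the gap between \<open>v\<close> and \<open>a\<close>, where
  that block has no points. Blocks of \<open>Q2\<close> lie to the right of \<open>a\<close>, from
  where \<open>v\<close> and \<open>a\<close> are interchangeable as left ends of a
  crossing.\<close>

lemma pointed_rec_glue:
  assumes v: "\<And>x. x \<in> A \<Longrightarrow> v < x" and a: "a \<in> A"
    and Q1: "Q1 \<in> NC (A \<inter> {..<a})" and BQ: "(B, Q2) \<in> pointed a (A \<inter> {a<..})"
  shows "(insert a B, Q1 \<union> Q2) \<in> pointed v A"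
proof -
  have B: "B \<subseteq> A \<inter> {a<..}" and Q2: "partition_on (A \<inter> {a<..} - B) Q2"
    and nc2: "noncrossing (insert (insert a B) Q2)"
    using BQ by (auto simp: pointed_def)
  have part1: "partition_on (A \<inter> {..<a}) Q1" and nc1: "noncrossing Q1"
    using Q1 by (auto simp: NC_def)
  have lt: "v < x" "x < a" if "C \<in> Q1" "x \<in> C" for C x
    using part1 that v by (auto simp: partition_on_def)
  have gt: "a < y" "y \<notin> B" if "C \<in> Q2" "y \<in> C" for C y
    using Q2 that by (auto simp: partition_on_def)
  have va: "v < a"
    using v a by blast
  have "partition_on (A - insert a B) (Q1 \<union> Q2)"
  proof (rule partition_onI)
    have "\<Union>(Q1 \<union> Q2) = A \<inter> {..<a} \<union> (A \<inter> {a<..} - B)"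
      using part1 Q2 by (simp add: partition_on_def)
    also have "\<dots> = A - insert a B"
      using B by auto
    finally show "\<Union>(Q1 \<union> Q2) = A - insert a B" .
    show "{} \<notin> Q1 \<union> Q2"
      using part1 Q2 by (simp add: partition_on_def)
    show "disjnt C D" if "C \<in> Q1 \<union> Q2" "D \<in> Q1 \<union> Q2" "C \<noteq> D" for C D
    proof -
      have "disjnt C D" if "C \<in> Q1" "D \<in> Q1"
        using part1 that \<open>C \<noteq> D\<close> by (auto simp: partition_on_def disjoint_def disjnt_def)
      moreover have "disjnt C D" if "C \<in> Q2" "D \<in> Q2"
        using Q2 that \<open>C \<noteq> D\<close> by (auto simp: partition_on_def disjoint_def disjnt_def)
      moreover have "disjnt C D" if "C \<in> Q1" "D \<in> Q2" for C D
        using lt(2) gt(1) that unfolding disjnt_iff by (meson less_asym)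
      ultimately show ?thesis
        using that by (auto simp: disjnt_sym)
    qed
  qed
  moreover have "noncrossing (insert (insert v (insert a B)) (Q1 \<union> Q2))"
  proof -
    let ?X = "insert v (insert a B)"
    have X: "x = v \<or> x = a \<or> a < x" if "x \<in> ?X" for x
      using that B by auto
    have n1: "\<not> crosses C D" if "C \<in> Q1" "D \<in> Q2" for C D
      using not_crosses_separated(1)[of C D] lt(2) gt(1) that less_trans by blast
    have n2: "\<not> crosses D C" if "C \<in> Q1" "D \<in> Q2" for C D
      using not_crosses_separated(2)[of C D] lt(2) gt(1) that less_trans by blast
    have n3: "\<not> crosses ?X C" if "C \<in> Q1" for C
    proof
      assume "crosses ?X C"
      then obtain x1 y1 x2 y2 where *: "x1 < y1" "y1 < x2" "x2 < y2" "x2 \<in> ?X" "y1 \<in> C" "y2 \<in> C"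
        unfolding crosses_def by blast
      then show False
        using lt[OF that, of y1] lt[OF that, of y2] X[of x2] by linarith
    qed
    have n4: "\<not> crosses C ?X" if "C \<in> Q1" for C
    proof
      assume "crosses C ?X"
      then obtain x1 y1 x2 y2 where *: "x1 < y1" "y1 < x2" "x1 \<in> C" "x2 \<in> C" "y1 \<in> ?X"
        unfolding crosses_def by blast
      then show False
        using lt[OF that, of x1] lt[OF that, of x2] X[of y1] by linarith
    qed
    have ne: "insert a B \<noteq> C" if "C \<in> Q2" for C
      using gt(1)[OF that, of a] by auto
    have n0: "\<not> crosses (insert a B) C" "\<not> crosses C (insert a B)" if "C \<in> Q2" for C
      using nc2 ne[OF that] that by (auto simp: noncrossing_def)
    have n5: "\<not> crosses ?X C" if "C \<in> Q2" for C
    proof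
      assume "crosses ?X C"
      then obtain x1 y1 x2 y2 where *: "x1 < y1" "y1 < x2" "x2 < y2" "x1 \<in> ?X" "x2 \<in> ?X" "y1 \<in> C" "y2 \<in> C"
        unfolding crosses_def by blast
      have y1: "a < y1"
        using gt(1)[OF that] * by blast
      then have "x2 \<in> insert a B"
        using * va by auto
      \<comment> \<open>The point \<open>a\<close> replaces \<open>x1\<close>, which may be
        \<open>v\<close>, so the crossing survives without \<open>v\<close>.\<close>
      moreover have "\<exists>x. x \<in> insert a B \<and> x < y1"
        using y1 by blast
      ultimately have "crosses (insert a B) C"
        unfolding crosses_def using * by blast
      then show False
        using n0 that by blast
    qed
    have n6: "\<not> crosses C ?X" if "C \<in> Q2" for C
    proof
      assume "crosses C ?X"
      then obtain x1 y1 x2 y2 where *: "x1 < y1" "y1 < x2" "x2 < y2" "x1 \<in> C" "x2 \<in> C" "y1 \<in> ?X" "y2 \<in> ?X"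
        unfolding crosses_def by blast
      have "a < x1"
        using gt(1)[OF that] * by blast
      then have "y1 \<in> insert a B" "y2 \<in> insert a B"
        using * va by auto
      then have "crosses C (insert a B)"
        unfolding crosses_def using * by blast
      then show False
        using n0 that by blast
    qed
    have n7: "\<not> crosses C D" if "C \<in> Q2" "D \<in> Q2" "C \<noteq> D" for C D
      using nc2 that by (simp add: noncrossing_def)
    show ?thesis
      using nc1 n7 by (auto simp: noncrossing_def n1 n2 n3 n4 n5 n6)
  qed
  ultimately show ?thesis
    using a B by (auto simp: pointed_def)
qed

text \<open>This inverts \<open>pointed_rec_glue\<close>: every other block lies entirely on one
  side of \<open>a\<close>, so \<open>Q\<close> falls apart into a left and a right part.\<close>

lemma pointed_rec_split:
  assumes fin: "finite A" and v: "\<And>x. x \<in> A \<Longrightarrow> v < x"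
    and BQ: "(B, Q) \<in> pointed v A" and "B \<noteq> {}"
  defines "a \<equiv> Min B"
  shows "a \<in> A" "{C \<in> Q. C \<subseteq> {..<a}} \<in> NC (A \<inter> {..<a})"
    "(B - {a}, {C \<in> Q. \<not> C \<subseteq> {..<a}}) \<in> pointed a (A \<inter> {a<..})"
proof -
  have B: "B \<subseteq> A" and Q: "partition_on (A - B) Q" and nc: "noncrossing (insert (insert v B) Q)"
    using BQ by (auto simp: pointed_def)
  have finB: "finite B"
    using fin B finite_subset by blast
  have aB: "a \<in> B" and le: "\<And>x. x \<in> B \<Longrightarrow> a \<le> x"
    unfolding a_def using finB \<open>B \<noteq> {}\<close> by auto
  show "a \<in> A"
    using aB B by blast
  have CA: "C \<subseteq> A - B" if "C \<in> Q" for C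
    using Q that by (auto simp: partition_on_def)
  \<comment> \<open>A block with points x < a < y would cross \<open>insert v B\<close> through v <
    x < a < y.\<close>
  have side: "C \<subseteq> {a<..}" if C: "C \<in> Q" "\<not> C \<subseteq> {..<a}" for C
  proof
    fix x assume x: "x \<in> C"
    obtain y where y: "y \<in> C" "a \<le> y"
      using C by force
    have ya: "a < y"
      using y CA[OF C(1)] aB by (metis DiffD2 le_neq_implies_less subsetD)
    have "C \<noteq> insert v B"
      using CA[OF C(1)] aB by blast
    then have "\<not> crosses (insert v B) C"
      using nc C by (auto simp: noncrossing_def)
    moreover have "v < x"
      using x CA[OF C(1)] v by blast
    ultimately have "\<not> x < a"
      unfolding crosses_def using x ya y(1) aB by blast
    moreover have "x \<noteq> a"
      using x CA[OF C(1)] aB by blast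
    ultimately show "x \<in> {a<..}"
      by simp
  qed
  have QU: "\<Union>Q = A - B" and Qd: "disjoint Q" and Qe: "{} \<notin> Q"
    using Q by (auto simp: partition_on_def)
  have "partition_on (A \<inter> {..<a}) {C \<in> Q. C \<subseteq> {..<a}}"
  proof (rule partition_onI)
    show "\<Union>{C \<in> Q. C \<subseteq> {..<a}} = A \<inter> {..<a}"
    proof
      show "\<Union>{C \<in> Q. C \<subseteq> {..<a}} \<subseteq> A \<inter> {..<a}"
        using CA by blast
      show "A \<inter> {..<a} \<subseteq> \<Union>{C \<in> Q. C \<subseteq> {..<a}}"
      proof
        fix x assume x: "x \<in> A \<inter> {..<a}"
        then have "x \<in> A - B"
          using le by force
        then obtain C where C: "C \<in> Q" "x \<in> C"
          using QU by blast
        then have "C \<subseteq> {..<a}"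
          using side[OF C(1)] x by fastforce
        then show "x \<in> \<Union>{C \<in> Q. C \<subseteq> {..<a}}"
          using C by blast
      qed
    qed
  qed (use Qd Qe in \<open>auto simp: disjoint_def disjnt_def\<close>)
  moreover have "noncrossing {C \<in> Q. C \<subseteq> {..<a}}"
    using nc by (rule noncrossing_subset) blast
  ultimately show "{C \<in> Q. C \<subseteq> {..<a}} \<in> NC (A \<inter> {..<a})"
    by (simp add: NC_def)
  let ?Q2 = "{C \<in> Q. \<not> C \<subseteq> {..<a}}"
  have "partition_on (A \<inter> {a<..} - (B - {a})) ?Q2"
  proof (rule partition_onI)
    show "\<Union>?Q2 = A \<inter> {a<..} - (B - {a})"
    proof
      show "\<Union>?Q2 \<subseteq> A \<inter> {a<..} - (B - {a})"
        using CA side by blast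
      show "A \<inter> {a<..} - (B - {a}) \<subseteq> \<Union>?Q2"
      proof
        fix x assume x: "x \<in> A \<inter> {a<..} - (B - {a})"
        then have "x \<in> A - B"
          by auto
        then obtain C where C: "C \<in> Q" "x \<in> C"
          using QU by blast
        moreover have "\<not> C \<subseteq> {..<a}"
          using C x by force
        ultimately show "x \<in> \<Union>?Q2"
          by blast
      qed
    qed
  qed (use Qd Qe in \<open>auto simp: disjoint_def disjnt_def\<close>)
  moreover have "noncrossing (insert (insert a (B - {a})) ?Q2)"
  proof -
    have B_eq: "insert a (B - {a}) = B"
      using aB by blast
    have "\<not> crosses B C \<and> \<not> crosses C B" if "C \<in> Q" for C
    proof -
      have "C \<noteq> insert v B"
        using CA[OF that] aB by blast
      then have "\<not> crosses (insert v B) C \<and> \<not> crosses C (insert v B)"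
        using nc that by (auto simp: noncrossing_def)
      then show ?thesis
        using crosses_mono[of B C "insert v B" C] crosses_mono[of C B C "insert v B"] by blast
    qed
    then show ?thesis
      using nc unfolding B_eq by (auto simp: noncrossing_def)
  qed
  ultimately show "(B - {a}, ?Q2) \<in> pointed a (A \<inter> {a<..})"
    using B le by (auto simp: pointed_def) (metis le_neq_implies_less)
qed

text \<open>The first term collects the pairs with \<open>B\<close> empty, where \<open>v\<close> is
  a singleton block. Otherwise \<open>a\<close> is \<open>Min B\<close>, the parts left and right of
  \<open>a\<close> are independent, and the shift of \<open>h\<close> records that \<open>a\<close>
  has been removed from \<open>B\<close>.\<close>

lemma pointed_sum_rec:
  assumes fin: "finite A" and v: "\<And>x. x \<in> A \<Longrightarrow> v < x"
  shows "pointed_sum f h v A = h 0 * nc_sum f A +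
    (\<Sum>a\<in>A. nc_sum f (A \<inter> {..<a}) * pointed_sum f (\<lambda>k. h (Suc k)) a (A \<inter> {a<..}))"
proof -
  define wt where "wt = (\<lambda>(B :: nat set, Q :: nat set set). h (card B) * (\<Prod>C\<in>Q. f (card C)))"
  let ?X0 = "{x \<in> pointed v A. fst x = {}}"
  let ?X1 = "{x \<in> pointed v A. fst x \<noteq> {}}"
  have "pointed_sum f h v A = sum wt (?X0 \<union> ?X1)"
    unfolding pointed_sum_def wt_def by (rule arg_cong[where f = "sum _"]) auto
  also have "\<dots> = sum wt ?X0 + sum wt ?X1"
    using pointed_finite[OF fin] by (intro sum.union_disjoint) auto
  also have "sum wt ?X0 = h 0 * nc_sum f A"
  proof -
    \<comment> \<open>A crossing needs two points in each block, so the singleton imposes no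
      condition on \<open>Q\<close>.\<close>
    have "\<not> crosses {v} C" "\<not> crosses C {v}" for C
      by (auto simp: crosses_def)
    then have "?X0 = Pair {} ` NC A"
      by (auto simp: pointed_def NC_def noncrossing_def)
    then have "sum wt ?X0 = (\<Sum>Q\<in>NC A. wt ({}, Q))"
      by (simp add: sum.reindex inj_on_def)
    then show ?thesis
      by (simp add: wt_def nc_sum_def sum_distrib_left)
  qed
  also have "sum wt ?X1 = (\<Sum>(a, Q1, B, Q2)\<in>(SIGMA a:A. NC (A \<inter> {..<a}) \<times> pointed a (A \<inter> {a<..})).
      (\<Prod>C\<in>Q1. f (card C)) * (h (Suc (card B)) * (\<Prod>C\<in>Q2. f (card C))))"
  proof (rule sum.reindex_bij_witness[where i = "\<lambda>(a, Q1, B, Q2). (insert a B, Q1 \<union> Q2)"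
        and j = "\<lambda>(B, Q). (Min B, {C \<in> Q. C \<subseteq> {..<Min B}}, B - {Min B}, {C \<in> Q. \<not> C \<subseteq> {..<Min B}})"])
    fix x assume "x \<in> ?X1"
    then obtain B Q where x: "x = (B, Q)" and BQ: "(B, Q) \<in> pointed v A" "B \<noteq> {}"
      by (cases x) auto
    note split = pointed_rec_split[OF fin v BQ]
    have finB: "finite B" and finQ: "finite Q"
      using BQ fin finite_elements[of "A - B" Q] by (auto simp: pointed_def intro: finite_subset)
    have Min: "Min B \<in> B"
      using finB BQ(2) by simp
    have Q_eq: "{C \<in> Q. C \<subseteq> {..<Min B}} \<union> {C \<in> Q. \<not> C \<subseteq> {..<Min B}} = Q"
      by blast
    show "(case case x of (B, Q) \<Rightarrow> (Min B, {C \<in> Q. C \<subseteq> {..<Min B}}, B - {Min B}, {C \<in> Q. \<not> C \<subseteq> {..<Min B}}) of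
           (a, Q1, B, Q2) \<Rightarrow> (insert a B, Q1 \<union> Q2)) = x"
      using Min Q_eq by (auto simp: x)
    show "(case x of (B, Q) \<Rightarrow> (Min B, {C \<in> Q. C \<subseteq> {..<Min B}}, B - {Min B}, {C \<in> Q. \<not> C \<subseteq> {..<Min B}}))
        \<in> (SIGMA a:A. NC (A \<inter> {..<a}) \<times> pointed a (A \<inter> {a<..}))"
      using split by (simp add: x)
    have "(\<Prod>C\<in>Q. f (card C)) =
        (\<Prod>C\<in>{C \<in> Q. C \<subseteq> {..<Min B}}. f (card C)) * (\<Prod>C\<in>{C \<in> Q. \<not> C \<subseteq> {..<Min B}}. f (card C))"
      using finQ by (subst prod.union_disjoint[symmetric]) (auto simp: Q_eq)
    moreover have "Suc (card (B - {Min B})) = card B"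
      using finB Min by (rule card.remove[symmetric])
    ultimately show "(case case x of (B, Q) \<Rightarrow> (Min B, {C \<in> Q. C \<subseteq> {..<Min B}}, B - {Min B}, {C \<in> Q. \<not> C \<subseteq> {..<Min B}}) of
        (a, Q1, B, Q2) \<Rightarrow> (\<Prod>C\<in>Q1. f (card C)) * (h (Suc (card B)) * (\<Prod>C\<in>Q2. f (card C)))) = wt x"
      by (simp add: x wt_def mult_ac)
  next
    fix y assume "y \<in> (SIGMA a:A. NC (A \<inter> {..<a}) \<times> pointed a (A \<inter> {a<..}))"
    then obtain a Q1 B Q2 where y: "y = (a, Q1, B, Q2)" and a: "a \<in> A"
      and Q1: "Q1 \<in> NC (A \<inter> {..<a})" and BQ: "(B, Q2) \<in> pointed a (A \<inter> {a<..})"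
      by auto
    show "(case y of (a, Q1, B, Q2) \<Rightarrow> (insert a B, Q1 \<union> Q2)) \<in> ?X1"
      using pointed_rec_glue[OF v a Q1 BQ] by (simp add: y)
    have B: "B \<subseteq> A \<inter> {a<..}" and Q2: "partition_on (A \<inter> {a<..} - B) Q2"
      using BQ by (auto simp: pointed_def)
    have finB: "finite B"
      using B fin by (auto intro: finite_subset)
    have Min: "Min (insert a B) = a"
      using finB B by (intro Min_eqI) auto
    have l: "C \<subseteq> {..<a}" if "C \<in> Q1" for C
      using NC_subsets[OF Q1 that] by blast
    have g: "\<not> C \<subseteq> {..<a}" if "C \<in> Q2" for C
    proof -
      have "C \<noteq> {}" "C \<subseteq> {a<..}"
        using Q2 that by (auto simp: partition_on_def)
      then show ?thesis
        by force
    qed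
    have "{C \<in> Q1 \<union> Q2. C \<subseteq> {..<a}} = Q1" "{C \<in> Q1 \<union> Q2. \<not> C \<subseteq> {..<a}} = Q2" "insert a B - {a} = B"
      using l g B by auto
    then show "(case case y of (a, Q1, B, Q2) \<Rightarrow> (insert a B, Q1 \<union> Q2) of
        (B, Q) \<Rightarrow> (Min B, {C \<in> Q. C \<subseteq> {..<Min B}}, B - {Min B}, {C \<in> Q. \<not> C \<subseteq> {..<Min B}})) = y"
      by (simp add: y Min)
  qed
  also have "\<dots> = (\<Sum>a\<in>A. nc_sum f (A \<inter> {..<a}) * pointed_sum f (\<lambda>k. h (Suc k)) a (A \<inter> {a<..}))"
    using fin
    by (simp add: nc_sum_def pointed_sum_def sum_product sum.cartesian_product case_prod_unfold,
        subst sum.Sigma) (auto simp: NC_finite pointed_finite case_prod_unfold)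
  finally show ?thesis .
qed

section \<open>Dependence of the weighted sums on cardinality alone\<close>

lemma bij_betw_rank:
  fixes A :: "nat set"
  assumes "finite A"
  shows "bij_betw (\<lambda>a. card (A \<inter> {..<a})) A {..<card A}"
proof -
  have less: "card (A \<inter> {..<a}) < card (A \<inter> {..<b})" if "a \<in> A" "a < b" for a b
    using assms that by (intro psubset_card_mono) auto
  have inj: "inj_on (\<lambda>a. card (A \<inter> {..<a})) A"
    by (rule linorder_inj_onI) (use less in \<open>force+\<close>)
  moreover have "(\<lambda>a. card (A \<inter> {..<a})) ` A \<subseteq> {..<card A}"
  proof -
    have "card (A \<inter> {..<a}) < card A" if "a \<in> A" for a
      using assms that by (intro psubset_card_mono) auto
    then show ?thesis by auto
  qed
  ultimately have "(\<lambda>a. card (A \<inter> {..<a})) ` A = {..<card A}"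
    by (intro card_subset_eq) (auto simp: card_image)
  with inj show ?thesis
    by (simp add: bij_betw_def)
qed

text \<open>The rank of \<open>a\<close> runs once through all values below \<open>card A\<close>,
  and it also fixes how many elements lie above \<open>a\<close>.\<close>

lemma sum_rank:
  fixes A :: "nat set"
  assumes "finite A"
  shows "(\<Sum>a\<in>A. F (card (A \<inter> {..<a})) (card (A \<inter> {a<..}))) = (\<Sum>i<card A. F i (card A - Suc i))"
proof -
  have "card (A \<inter> {a<..}) = card A - Suc (card (A \<inter> {..<a}))" if "a \<in> A" for a
  proof -
    have "A \<inter> {..<a} \<union> insert a (A \<inter> {a<..}) = A"
      using that by auto
    moreover have "card (A \<inter> {..<a} \<union> insert a (A \<inter> {a<..})) =
        card (A \<inter> {..<a}) + card (insert a (A \<inter> {a<..}))"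
      using assms by (intro card_Un_disjoint) auto
    ultimately have "card A = card (A \<inter> {..<a}) + card (insert a (A \<inter> {a<..}))"
      by simp
    then show ?thesis
      using assms by simp
  qed
  then have "(\<Sum>a\<in>A. F (card (A \<inter> {..<a})) (card (A \<inter> {a<..}))) =
      (\<Sum>a\<in>A. (\<lambda>i. F i (card A - Suc i)) (card (A \<inter> {..<a})))"
    by simp
  also have "\<dots> = (\<Sum>i<card A. F i (card A - Suc i))"
    by (rule sum.reindex_bij_betw[OF bij_betw_rank[OF assms]])
  finally show ?thesis .
qed

text \<open>A fixed model set is used here and in \<open>pointed_count\<close>; independence of the
  model is \<open>nc_sum_eq_count_aux\<close>. The base point 0 of \<open>pointed_count\<close> lies
  to the left of its model set \<open>{1..n}\<close>.\<close>

definition nc_count :: "(nat \<Rightarrow> 'a::comm_semiring_1) \<Rightarrow> nat \<Rightarrow> 'a" where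
  "nc_count f n = nc_sum f {..<n}"

definition pointed_count :: "(nat \<Rightarrow> 'a::comm_semiring_1) \<Rightarrow> (nat \<Rightarrow> 'a) \<Rightarrow> nat \<Rightarrow> 'a" where
  "pointed_count f h n = pointed_sum f h 0 {1..n}"

text \<open>Both claims go through one strong induction, as each sum recurs to the other. The claim
  for \<open>nc_sum\<close> is settled first at each size, because the \<open>h 0\<close> term of
  \<open>pointed_sum_rec\<close> keeps the whole set.\<close>

lemma nc_sum_eq_count_aux:
  assumes "finite A"
  shows "nc_sum f A = nc_count f (card A) \<and>
    (\<forall>v h. (\<forall>x\<in>A. v < x) \<longrightarrow> pointed_sum f h v A = pointed_count f h (card A))"
  using assms
proof (induction "card A" arbitrary: A rule: less_induct)
  case less
  \<comment> \<open>Removing the minimum reaches a smaller set, where the induction hypothesis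
    applies. A general \<open>A'\<close> lets this serve both for a given set and for the model set
    \<open>{..<card A'}\<close>.\<close>
  have nc_rec: "nc_sum f A' = pointed_count f (\<lambda>k. f (Suc k)) (card A' - 1)"
    if "finite A'" "A' \<noteq> {}" "card A' = card A" for A'
  proof -
    let ?B = "A' - {Min A'}"
    have Min: "Min A' \<in> A'"
      using that by simp
    then have ins: "insert (Min A') ?B = A'"
      by auto
    have "Suc (card ?B) = card A'"
      using card.remove[OF \<open>finite A'\<close> Min] by simp
    then have c: "card ?B = card A' - 1" "card ?B < card A"
      using that by linarith+
    have "nc_sum f A' = pointed_sum f (\<lambda>k. f (Suc k)) (Min A') ?B"
      using nc_sum_eq_pointed_sum[of ?B "Min A'" f] that unfolding ins by simp
    also have "\<dots> = pointed_count f (\<lambda>k. f (Suc k)) (card ?B)"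
    proof -
      have "\<forall>x\<in>?B. Min A' < x"
        using that by (auto simp: order.strict_iff_order)
      then show ?thesis
        using less.hyps[OF c(2)] that by auto
    qed
    finally show ?thesis
      using c by simp
  qed
  have W: "nc_sum f A' = nc_count f (card A')" if "finite A'" "card A' = card A" for A'
  proof (cases "A' = {}")
    case True
    then show ?thesis by (simp add: nc_count_def)
  next
    case False
    then have "card A' > 0"
      using card_gt_0_iff that(1) by blast
    then have "{..<card A'} \<noteq> {}"
      by blast
    then show ?thesis
      using nc_rec[of A'] nc_rec[of "{..<card A'}"] that False by (simp add: nc_count_def)
  qed
  \<comment> \<open>The right-hand side sees only \<open>card A\<close>, so comparing
    \<open>A\<close> with the model \<open>{1..card A}\<close> and base point 0 gives the second
    claim.\<close>
  have T: "pointed_sum f h v A' = h 0 * nc_count f (card A) +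
      (\<Sum>i<card A. nc_count f i * pointed_count f (\<lambda>k. h (Suc k)) (card A - Suc i))"
    if fin: "finite A'" and cA: "card A' = card A" and v: "\<forall>x\<in>A'. v < x" for A' v h
  proof -
    have "(\<Sum>a\<in>A'. nc_sum f (A' \<inter> {..<a}) * pointed_sum f (\<lambda>k. h (Suc k)) a (A' \<inter> {a<..})) =
        (\<Sum>a\<in>A'. nc_count f (card (A' \<inter> {..<a})) * pointed_count f (\<lambda>k. h (Suc k)) (card (A' \<inter> {a<..})))"
    proof (rule sum.cong[OF refl])
      fix a assume a: "a \<in> A'"
      have "card (A' \<inter> {..<a}) < card A" "card (A' \<inter> {a<..}) < card A"
        unfolding cA[symmetric] using fin a by (auto intro!: psubset_card_mono)
      then show "nc_sum f (A' \<inter> {..<a}) * pointed_sum f (\<lambda>k. h (Suc k)) a (A' \<inter> {a<..}) =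
          nc_count f (card (A' \<inter> {..<a})) * pointed_count f (\<lambda>k. h (Suc k)) (card (A' \<inter> {a<..}))"
        using less.hyps fin by simp
    qed
    also have "\<dots> = (\<Sum>i<card A. nc_count f i * pointed_count f (\<lambda>k. h (Suc k)) (card A - Suc i))"
      using sum_rank[OF fin, of "\<lambda>i j. nc_count f i * pointed_count f (\<lambda>k. h (Suc k)) j"]
      by (simp add: cA)
    finally show ?thesis
      using pointed_sum_rec[OF fin, of v f h] v W[OF fin cA] cA by simp
  qed
  show ?case
    using W[OF less.prems] T[OF less.prems] T[of "{1..card A}" 0] by (simp add: pointed_count_def)
qed

lemma nc_sum_eq_count: "finite A \<Longrightarrow> nc_sum f A = nc_count f (card A)"
  using nc_sum_eq_count_aux by blast

lemma pointed_sum_eq_count: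
  "finite A \<Longrightarrow> (\<And>x. x \<in> A \<Longrightarrow> v < x) \<Longrightarrow> pointed_sum f h v A = pointed_count f h (card A)"
  using nc_sum_eq_count_aux by blast

lemma nc_count_0: "nc_count f 0 = 1"
  by (simp add: nc_count_def nc_sum_empty)

lemma nc_count_Suc: "nc_count f (Suc n) = pointed_count f (\<lambda>k. f (Suc k)) n"
proof -
  have "nc_count f (Suc n) = nc_sum f (insert 0 {1..n})"
    by (subst nc_sum_eq_count) auto
  then show ?thesis
    by (subst (asm) nc_sum_eq_pointed_sum) (auto simp: pointed_count_def)
qed

lemma pointed_count_rec:
  "pointed_count f h n = h 0 * nc_count f n +
    (\<Sum>i<n. nc_count f i * pointed_count f (\<lambda>k. h (Suc k)) (n - Suc i))"
proof -
  have "pointed_count f h n = h 0 * nc_sum f {1..n} +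
    (\<Sum>a\<in>{1..n}. nc_sum f ({1..n} \<inter> {..<a}) * pointed_sum f (\<lambda>k. h (Suc k)) a ({1..n} \<inter> {a<..}))"
    unfolding pointed_count_def by (rule pointed_sum_rec) auto
  also have "\<dots> = h 0 * nc_count f n + (\<Sum>a\<in>{1..n}. nc_count f (card ({1..n} \<inter> {..<a})) *
      pointed_count f (\<lambda>k. h (Suc k)) (card ({1..n} \<inter> {a<..})))"
    by (subst pointed_sum_eq_count) (auto simp: nc_sum_eq_count)
  finally show ?thesis
    using sum_rank[of "{1..n}" "\<lambda>i j. nc_count f i * pointed_count f (\<lambda>k. h (Suc k)) j"] by simp
qed

section \<open>Generating functions\<close>

text \<open>This is the coefficient form of
  \<open>H ^ Suc r = H ^ r + fps_X ^ p * H ^ (r + k)\<close>. With M = k(n+1) + r, all three terms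
  are rational multiples of \<open>c\<close>, and the claim becomes (r+1) M = r (M-n) +
  (r+k)(n+1).\<close>

lemma fuss_catalan_power_rec:
  fixes k n r :: nat
  assumes "k > 0"
  defines "a \<equiv> \<lambda>r n. real r / real (k * n + r) * real ((k * n + r) choose n)"
  shows "a (Suc r) (Suc n) = a r (Suc n) + a (r + k) n"
proof -
  define M where "M = k * Suc n + r"
  define c where "c = real (M choose n)"
  have M: "M > 0"
    using assms(1) by (simp add: M_def)
  have "n \<le> k * n"
    using assms(1) by simp
  then have Mn: "n \<le> M"
    unfolding M_def mult_Suc_right by linarith
  have up: "real (M choose Suc n) = c * (real M - real n) / real (Suc n)"
  proof -
    have "Suc n * (M choose Suc n) = (M choose n) * (M - n)"
      using binomial_absorb_comp[of M n] binomial_absorption[of n M]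
      by (simp add: mult.commute)
    then have "real (Suc n) * real (M choose Suc n) = c * (real M - real n)"
      unfolding c_def by (metis Mn of_nat_diff of_nat_mult)
    then show ?thesis
      by (simp add: field_simps)
  qed
  have diag: "real (Suc M choose Suc n) = c * real (Suc M) / real (Suc n)"
    using binomial_absorption[of n M] Suc_times_binomial[of n M] unfolding c_def
    by (metis nonzero_mult_div_cancel_left of_nat_mult of_nat_neq_0 mult.commute)
  have "a (Suc r) (Suc n) = real (Suc r) / real (Suc M) * real (Suc M choose Suc n)"
    by (simp only: a_def M_def add_Suc_right)
  also have "\<dots> = real (Suc r) * c / real (Suc n)"
    unfolding diag by simp
  also have "\<dots> = real r / real M * real (M choose Suc n) + real (r + k) / real M * c"
    unfolding up using M by (simp add: divide_simps) (simp add: M_def algebra_simps)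
  also have "\<dots> = a r (Suc n) + a (r + k) n"
    by (simp add: a_def M_def c_def algebra_simps)
  finally show ?thesis .
qed

text \<open>
  Multiplying the equation for \<open>H\<close> by \<open>H ^ r\<close> gives a recurrence in \<open>n\<close> and \<open>r\<close> that determines
  the coefficients of all powers at once, which takes the place of Lagrange inversion.
\<close>

lemma fps_fuss_catalan_power_nth:
  fixes H :: "real fps"
  assumes H: "H = 1 + fps_X ^ p * H ^ k" and "k > 0" "p > 0"
  shows "(H ^ r) $ (p * n) =
    (if n = 0 then 1 else real r / real (k * n + r) * real ((k * n + r) choose n))"
proof (induction n arbitrary: r)
  \<comment> \<open>At n = r = 0 the closed formula would read 0/0, which evaluates to 0, while
    \<open>H ^ 0\<close> has constant coefficient 1; hence the separate case.\<close>
  case 0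
  have "H $ 0 = (1 + fps_X ^ p * H ^ k) $ 0"
    using H by simp
  then have "H $ 0 = 1"
    using \<open>p > 0\<close> by (simp add: fps_X_power_mult_nth)
  then show ?case
    by (simp add: fps_power_zeroth)
next
  case (Suc n)
  show ?case
  \<comment> \<open>The inner induction lowers the exponent at fixed degree. The term of exponent
    \<open>r + k\<close> has lower degree and is covered by the outer hypothesis for arbitrary
    exponents.\<close>
  proof (induction r)
    case 0
    then show ?case using \<open>p > 0\<close> by simp
  next
    case (Suc r)
    have "H ^ Suc r = (1 + fps_X ^ p * H ^ k) * H ^ r"
      using H by simp
    also have "\<dots> = H ^ r + fps_X ^ p * H ^ (r + k)"
      by (simp add: algebra_simps power_add)
    finally have "(H ^ Suc r) $ (p * Suc n) = (H ^ r) $ (p * Suc n) + (H ^ (r + k)) $ (p * n)"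
      by (simp add: fps_X_power_mult_nth)
    also have "(H ^ (r + k)) $ (p * n) =
        real (r + k) / real (k * n + (r + k)) * real ((k * n + (r + k)) choose n)"
      using \<open>k > 0\<close> \<open>\<And>r. (H ^ r) $ (p * n) = _ r\<close> by simp
    finally show ?case
      using Suc fuss_catalan_power_rec[OF \<open>k > 0\<close>, of r n] by simp
  qed
qed

text \<open>
  A block of a partition is never empty, so \<open>f 0\<close> carries no information and is replaced by 1,
  the weight of the empty partition.
\<close>

definition weighted_fps :: "(nat \<Rightarrow> real) \<Rightarrow> real fps" where
  "weighted_fps f = Abs_fps (\<lambda>k. if k = 0 then 1 else f k)"

text \<open>Here \<open>w\<close> and \<open>t\<close> abstract \<open>nc_count f\<close> and
  \<open>pointed_count f\<close>. One step of the recursion for \<open>t\<close> contributes a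
  factor \<open>fps_X * G\<close> and shifts \<open>h\<close>, so unrolling it lists the values of
  \<open>h\<close> as coefficients of the powers of \<open>fps_X * G\<close>.\<close>

lemma fps_compose_fixpoint:
  fixes w :: "nat \<Rightarrow> real" and t :: "(nat \<Rightarrow> real) \<Rightarrow> nat \<Rightarrow> real"
  assumes w0: "w 0 = 1" and wSuc: "\<And>n. w (Suc n) = t (\<lambda>k. f (Suc k)) n"
    and t: "\<And>h n. t h n = h 0 * w n + (\<Sum>i<n. w i * t (\<lambda>k. h (Suc k)) (n - Suc i))"
  shows "weighted_fps w = weighted_fps f oo (fps_X * weighted_fps w)"
proof -
  define G where "G = Abs_fps w"
  define T where "T h = Abs_fps (t h)" for h
  have G: "weighted_fps w = G"
    by (auto simp: weighted_fps_def G_def w0 fps_eq_iff)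
  have T: "T h = G * (fps_const (h 0) + fps_X * T (\<lambda>k. h (Suc k)))" for h
  proof (rule fps_ext)
    fix n
    have "(G * T (\<lambda>k. h (Suc k))) $ (n - 1) = (\<Sum>i<n. w i * t (\<lambda>k. h (Suc k)) (n - Suc i))" if "n > 0"
      using that unfolding fps_mult_nth G_def T_def
      by (intro sum.cong) auto
    then show "T h $ n = (G * (fps_const (h 0) + fps_X * T (\<lambda>k. h (Suc k)))) $ n"
      unfolding distrib_left mult.left_commute[of G fps_X]
      by (cases "n = 0") (simp_all add: t[of h n] t[of h 0] T_def G_def mult.commute)
  qed
  \<comment> \<open>Unrolling \<open>K\<close> times leaves a remainder divisible by
    \<open>fps_X ^ K\<close>.\<close>
  have T_expand: "T h = (\<Sum>k<K. fps_const (h k) * fps_X ^ k * G ^ Suc k) + fps_X ^ K * G ^ K * T (\<lambda>k. h (k + K))"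
    for h K
  proof (induction K)
    case (Suc K)
    have "T (\<lambda>k. h (k + K)) = G * (fps_const (h K) + fps_X * T (\<lambda>k. h (k + Suc K)))"
      using T[of "\<lambda>k. h (k + K)"] by simp
    then show ?case
      using Suc by (simp add: algebra_simps)
  qed simp
  show ?thesis
    unfolding G
  proof (rule fps_ext)
    fix n
    show "G $ n = (weighted_fps f oo (fps_X * G)) $ n"
    proof (cases n)
      case 0
      then show ?thesis by (simp add: G_def w0 weighted_fps_def)
    next
      case (Suc m)
      have "G $ n = T (\<lambda>k. f (Suc k)) $ m"
        by (simp add: Suc G_def T_def wSuc)
      also have "\<dots> = (\<Sum>k\<le>m. f (Suc k) * (fps_X ^ k * G ^ Suc k) $ m)"
        \<comment> \<open>With \<open>K = Suc m\<close> the remainder does not reach degree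
          \<open>m\<close>.\<close>
        by (subst T_expand[of _ "Suc m"])
          (simp add: fps_sum_nth mult.assoc fps_X_power_mult_nth lessThan_Suc_atMost del: power_Suc)
      \<comment> \<open>One more factor \<open>fps_X\<close> raises the degree from \<open>m\<close>
        to \<open>n\<close> and completes the power of \<open>fps_X * G\<close>.\<close>
      also have "\<dots> = (\<Sum>k\<le>m. weighted_fps f $ Suc k * ((fps_X * G) ^ Suc k) $ n)"
        by (intro sum.cong) (simp_all add: weighted_fps_def power_mult_distrib Suc mult.assoc mult.left_commute[of G])
      \<comment> \<open>The added term for k = 0 vanishes, as the constant 1 has no coefficient at
        the positive degree \<open>n\<close>.\<close>
      also have "\<dots> = (\<Sum>k\<in>{0..n}. weighted_fps f $ k * ((fps_X * G) ^ k) $ n)"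
        by (simp add: atMost_atLeast0 Suc sum.atLeast0_atMost_Suc_shift del: power_Suc sum.cl_ivl_Suc)
      finally show ?thesis
        by (simp add: fps_compose_nth)
    qed
  qed
qed

text \<open>
  The number of chains of \<open>m\<close> partitions of a set with \<open>k > 0\<close> elements; for \<open>m = 0\<close> the set
  itself plays the role of the block that must have \<open>p\<close> elements.
\<close>

primrec chain_weight :: "nat \<Rightarrow> nat \<Rightarrow> nat \<Rightarrow> real" where
  "chain_weight p 0 = (\<lambda>k. if k = p then 1 else 0)"
| "chain_weight p (Suc m) = nc_count (chain_weight p m)"

lemma weighted_fps_nc_count:
  "weighted_fps (nc_count f) = weighted_fps f oo (fps_X * weighted_fps (nc_count f))"
  by (rule fps_compose_fixpoint[where t = "pointed_count f"])
    (simp_all add: nc_count_0 nc_count_Suc pointed_count_rec[symmetric])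

text \<open>Substituting Y = x F_(m+1) into the equation for F_m turns each F_m into F_(m+1) and x^p
  into Y^p. The latter supplies p further factors F_(m+1), raising the exponent from mp to
  (m+1)p.\<close>

lemma weighted_fps_chain_weight:
  assumes "p > 0"
  defines "F \<equiv> \<lambda>m. weighted_fps (chain_weight p m)"
  shows "F m = 1 + fps_X ^ p * F m ^ (m * p)"
proof (induction m)
  case 0
  show ?case
    using assms(1) by (auto simp: F_def weighted_fps_def fps_eq_iff fps_X_power_nth)
next
  case (Suc m)
  let ?Y = "fps_X * F (Suc m)"
  have "F (Suc m) = F m oo ?Y"
    using weighted_fps_nc_count by (simp add: F_def)
  moreover have "F m oo ?Y = (1 + fps_X ^ p * F m ^ (m * p)) oo ?Y"
    using Suc by simp
  moreover have "\<dots> = 1 + ?Y ^ p * (F m oo ?Y) ^ (m * p)"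
    by (simp add: fps_compose_add_distrib fps_compose_mult_distrib fps_compose_power[symmetric]
        fps_X_fps_compose_startby0)
  ultimately have "F (Suc m) = 1 + ?Y ^ p * F (Suc m) ^ (m * p)"
    by metis
  then show ?case
    by (simp add: power_mult_distrib power_add mult.assoc)
qed

section \<open>Chains of noncrossing partitions\<close>

text \<open>The top \<open>P\<close> is fixed and not part of the list. Appending it makes entry 0
  exist even for m = 0, where the block size condition falls on \<open>P\<close> itself.\<close>

definition chains_below :: "nat \<Rightarrow> nat set \<Rightarrow> nat \<Rightarrow> nat set set \<Rightarrow> nat set set list set" where
  "chains_below p A m P = {Ps. length Ps = m \<and> set Ps \<subseteq> NC A \<and>
     (\<forall>i<m. refines A ((Ps @ [P]) ! i) ((Ps @ [P]) ! Suc i)) \<and> (\<forall>B\<in>(Ps @ [P]) ! 0. card B = p)}"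

lemma chains_below_0: "chains_below p A 0 P = (if \<forall>B\<in>P. card B = p then {[]} else {})"
  by (auto simp: chains_below_def)

lemma chains_below_snoc:
  "Ps @ [Q] \<in> chains_below p A (Suc m) P \<longleftrightarrow>
    Q \<in> NC A \<and> refines A Q P \<and> Ps \<in> chains_below p A m Q"
  by (auto simp: chains_below_def less_Suc_eq nth_append all_conj_distrib)

lemma chains_below_Suc:
  "chains_below p A (Suc m) P =
    (\<Union>Q\<in>{Q. Q \<in> NC A \<and> refines A Q P}. (\<lambda>Ps. Ps @ [Q]) ` chains_below p A m Q)" (is "?L = ?R")
proof (rule set_eqI)
  fix Ps
  show "Ps \<in> ?L \<longleftrightarrow> Ps \<in> ?R"
  proof (cases Ps rule: rev_cases)
    case Nil
    then show ?thesis by (auto simp: chains_below_def)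
  next
    case (snoc Qs Q)
    then show ?thesis by (auto simp: chains_below_snoc)
  qed
qed

text \<open>The last entry of a list reveals its \<open>Q\<close>, so the images are
  disjoint.\<close>

lemma card_UN_snoc:
  assumes "finite X" "\<And>Q. Q \<in> X \<Longrightarrow> finite (S Q)"
  shows "finite (\<Union>Q\<in>X. (\<lambda>Ps. Ps @ [Q]) ` S Q)"
    "card (\<Union>Q\<in>X. (\<lambda>Ps. Ps @ [Q]) ` S Q) = (\<Sum>Q\<in>X. card (S Q))"
proof -
  show "finite (\<Union>Q\<in>X. (\<lambda>Ps. Ps @ [Q]) ` S Q)"
    using assms by simp
  have "card (\<Union>Q\<in>X. (\<lambda>Ps. Ps @ [Q]) ` S Q) = (\<Sum>Q\<in>X. card ((\<lambda>Ps. Ps @ [Q]) ` S Q))"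
    using assms by (intro card_UN_disjoint) auto
  then show "card (\<Union>Q\<in>X. (\<lambda>Ps. Ps @ [Q]) ` S Q) = (\<Sum>Q\<in>X. card (S Q))"
    by (simp add: card_image inj_on_def)
qed

text \<open>Induction on \<open>m\<close> for all tops at once: the coarsest entry \<open>Q\<close>
  below \<open>P\<close> becomes the new top, and \<open>sum_prod_refinements\<close> regroups the
  sum over \<open>Q\<close> by the blocks of \<open>P\<close>. Each factor is then the next
  \<open>chain_weight\<close>.\<close>

lemma card_chains_below:
  assumes A: "finite A" and P: "P \<in> NC A"
  shows "finite (chains_below p A m P) \<and>
    real (card (chains_below p A m P)) = (\<Prod>B\<in>P. chain_weight p m (card B))"
  using P
proof (induction m arbitrary: P)
  case 0
  then show ?case
    using NC_finite_elem[OF A 0] by (auto simp: chains_below_0)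
next
  case (Suc m)
  let ?X = "{Q. Q \<in> NC A \<and> refines A Q P}"
  have X: "finite ?X"
    using NC_finite[OF A] by simp
  have finB: "finite B" if "B \<in> P" for B
    using NC_subsets[OF Suc.prems that] A finite_subset by blast
  note card = card_UN_snoc[OF X, of "chains_below p A m", folded chains_below_Suc]
  have "real (card (chains_below p A (Suc m) P)) = (\<Sum>Q\<in>?X. \<Prod>C\<in>Q. chain_weight p m (card C))"
    using Suc.IH by (subst card(2)) auto
  also have "\<dots> = (\<Prod>B\<in>P. \<Sum>Q\<in>NC B. \<Prod>C\<in>Q. chain_weight p m (card C))"
    by (rule sum_prod_refinements[OF A Suc.prems])
  also have "\<dots> = (\<Prod>B\<in>P. chain_weight p (Suc m) (card B))"
    using finB by (intro prod.cong) (simp_all add: nc_sum_eq_count flip: nc_sum_def)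
  finally show ?case
    using card(1) Suc.IH by simp
qed

text \<open>The last entry becomes the fixed top, with the remaining \<open>m\<close> entries
  forming a chain below it.\<close>

lemma planar_chains_eq:
  "planar_chains (Suc m) p n =
    (\<Union>Q\<in>NC {1..p * n}. (\<lambda>Ps. Ps @ [Q]) ` chains_below p {1..p * n} m Q)" (is "?L = ?R")
proof (rule set_eqI)
  fix Ps
  show "Ps \<in> ?L \<longleftrightarrow> Ps \<in> ?R"
  proof (cases Ps rule: rev_cases)
    case Nil
    then show ?thesis by (auto simp: planar_chains_def)
  next
    case (snoc Qs Q)
    have "Ps \<in> ?L \<longleftrightarrow> length Qs = m \<and> set (Qs @ [Q]) \<subseteq> NC {1..p * n} \<and>
        (\<forall>i<m. refines {1..p * n} ((Qs @ [Q]) ! i) ((Qs @ [Q]) ! Suc i)) \<and>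
        p_partition p n ((Qs @ [Q]) ! 0)"
      by (auto simp: snoc planar_chains_def planar_partition_iff subset_iff in_set_conv_nth
          simp del: set_append)
    also have "\<dots> \<longleftrightarrow> Q \<in> NC {1..p * n} \<and> Qs \<in> chains_below p {1..p * n} m Q"
    proof -
      \<comment> \<open>Membership in \<open>NC {1..p * n}\<close> supplies the partition half of
        \<open>p_partition\<close>, leaving the block size condition of
        \<open>chains_below\<close>.\<close>
      have "p_partition p n ((Qs @ [Q]) ! 0) \<longleftrightarrow> (\<forall>B\<in>(Qs @ [Q]) ! 0. card B = p)"
        if "set (Qs @ [Q]) \<subseteq> NC {1..p * n}"
      proof -
        have "(Qs @ [Q]) ! 0 \<in> set (Qs @ [Q])"
          by (rule nth_mem) simp
        then show ?thesis
          using that NC_partition by (auto simp: p_partition_def)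
      qed
      then show ?thesis
        by (auto simp: chains_below_def)
    qed
    finally show ?thesis
      using snoc by auto
  qed
qed

theorem theorem3:
  fixes m p n :: nat
  assumes "m > 0" and "p > 0" and "n > 0"
  shows "real (card (planar_chains m p n)) = fuss_catalan (m * p) n"
proof -
  obtain m' where m: "m = Suc m'"
    using \<open>m > 0\<close> gr0_implies_Suc by blast
  let ?A = "{1..p * n}" and ?F = "weighted_fps (chain_weight p m)"
  have "real (card (planar_chains m p n)) = (\<Sum>Q\<in>NC ?A. \<Prod>B\<in>Q. chain_weight p m' (card B))"
    unfolding m planar_chains_eq
    using card_chains_below[of ?A _ p m']
    by (subst card_UN_snoc(2)) (simp_all add: NC_finite)
  also have "\<dots> = chain_weight p m (p * n)"
    using nc_sum_eq_count[of ?A "chain_weight p m'"] by (simp add: m flip: nc_sum_def)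
  \<comment> \<open>Since \<open>p * n\<close> is positive, \<open>weighted_fps\<close> keeps the
    weight there. The exponent 1 matches the power formula with \<open>r = 1\<close> and
    \<open>k = m * p\<close>.\<close>
  also have "\<dots> = (?F ^ 1) $ (p * n)"
    using assms by (simp add: weighted_fps_def)
  also have "\<dots> = fuss_catalan (m * p) n"
    using fps_fuss_catalan_power_nth[OF weighted_fps_chain_weight, of p m 1 n] assms
    by (simp add: fuss_catalan_def)
  finally show ?thesis .
qed

end
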